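(* Let $m,n$ be positive integers, $a,b$ non-negative integers with $a+b=n$, and $x,y$ complex numbers with $ax+by=0$. Define \[ R_{3,4}(x,y;m,n;\tau)= mn\sum_{\substack{r_1,\ldots,r_a,s_1,\ldots,s_b\in\mathbb{Z}\\ r_1+\cdots+r_a+s_1+\cdots+s_b=0}}(-1)^{s_1+\cdots+s_b}q^{r_1^2+\cdots+r_a^2+s_1^2+\cdots+s_b^2}e^{2i((r_1+\cdots+r_a)x+(s_1+\cdots+s_b)y)}. \] Let $S(z)=\sum_{k=0}^{mn-1}\vartheta_3^{a}\!\left(z+x+\tfrac{k\pi}{mn}\Big|\tau\right)\vartheta_4^{b}\!\left(z+y+\tfrac{k\pi}{mn}\Big|\tau\right)$. Then for all $z\in\mathbb{C}$: if $mb$ is even, $S(z)=R_{3,4}(x,y;m,n;\tau)\,\vartheta_3(mnz\,|\,m^2n\tau)$; if $mb$ is odd, $S(z)=R_{3,4}(x,y;m,n;\tau)\,\vartheta_4(mnz\,|\,m^2n\tau)$.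
   Context: Throughout, $\tau\in\mathbb{C}$ with $\Im(\tau)>0$ and $q=e^{\pi i\tau}$. The Jacobi theta functions are $\vartheta_3(z|\tau)=\sum_{n\in\mathbb{Z}}q^{n^2}e^{2niz}$ and $\vartheta_4(z|\tau)=\sum_{n\in\mathbb{Z}}(-1)^nq^{n^2}e^{2niz}$; $\vartheta_j(z|m^2n\tau)$ denotes the same function with $\tau$ replaced by $m^2n\tau$. A zeroth power equals $1$. *)

theory Defs
  imports "HOL-Analysis.Analysis"
begin

definition nome :: "complex \<Rightarrow> complex" where
  "nome \<tau> = exp (of_real pi * \<i> * \<tau>)"

definition theta3 :: "complex \<Rightarrow> complex \<Rightarrow> complex" where
  "theta3 z \<tau> = (\<Sum>\<^sub>\<infinity>n\<in>(UNIV :: int set).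
     nome \<tau> powi (n\<^sup>2) * exp (2 * of_int n * \<i> * z))"

definition theta4 :: "complex \<Rightarrow> complex \<Rightarrow> complex" where
  "theta4 z \<tau> = (\<Sum>\<^sub>\<infinity>n\<in>(UNIV :: int set).
     (-1) powi n * nome \<tau> powi (n\<^sup>2) * exp (2 * of_int n * \<i> * z))"

text \<open>
  Integer tuples \<open>(r\<^sub>1, \<dots>, r\<^sub>a)\<close> are functions on \<open>{1..a}\<close> in the extensional function
  space, so that distinct functions are distinct tuples; for \<open>a = 0\<close> there is exactly
  one, the empty tuple.
\<close>

definition zero_sum_tuples :: "nat \<Rightarrow> nat \<Rightarrow> ((nat \<Rightarrow> int) \<times> (nat \<Rightarrow> int)) set" where
  "zero_sum_tuples a b =
     {(r, s). r \<in> {1..a} \<rightarrow>\<^sub>E UNIV \<and> s \<in> {1..b} \<rightarrow>\<^sub>E UNIV \<and>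
              (\<Sum>j=1..a. r j) + (\<Sum>j=1..b. s j) = 0}"

definition R34 ::
  "nat \<Rightarrow> nat \<Rightarrow> complex \<Rightarrow> complex \<Rightarrow> nat \<Rightarrow> nat \<Rightarrow> complex \<Rightarrow> complex" where
  "R34 a b x y m n \<tau> = of_nat (m * n) *
     (\<Sum>\<^sub>\<infinity>(r, s)\<in>zero_sum_tuples a b.
        (-1) powi (\<Sum>j=1..b. s j) *
        nome \<tau> powi ((\<Sum>j=1..a. (r j)\<^sup>2) + (\<Sum>j=1..b. (s j)\<^sup>2)) *
        exp (2 * \<i> * (of_int (\<Sum>j=1..a. r j) * x + of_int (\<Sum>j=1..b. s j) * y)))"

definition S34 ::
  "nat \<Rightarrow> nat \<Rightarrow> complex \<Rightarrow> complex \<Rightarrow> nat \<Rightarrow> nat \<Rightarrow> complex \<Rightarrow> complex \<Rightarrow> complex" where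
  "S34 a b x y m n \<tau> z =
     (\<Sum>k<m * n. theta3 (z + x + of_nat k * of_real pi / of_nat (m * n)) \<tau> ^ a *
                 theta4 (z + y + of_nat k * of_real pi / of_nat (m * n)) \<tau> ^ b)"

end

theory Submission
  imports Defs
begin

text \<open>
  Since \<open>\<vartheta>\<^sub>4(z) = \<vartheta>\<^sub>3(z + \<pi>/2)\<close>, it suffices to treat \<open>\<Prod>\<^sub>j \<vartheta>\<^sub>3(w + x\<^sub>j)\<close> with \<open>n\<close> arbitrary
  arguments \<open>x\<^sub>j\<close>. This product is an absolutely convergent sum over \<open>r \<in> \<int>\<^sup>n\<close> in which \<open>w\<close> enters
  only through \<open>exp(2i(\<Sum>r)w)\<close>. Summing over the arguments \<open>w + k\<pi>/(mn)\<close> therefore sums powers of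
  \<open>mn\<close>-th roots of unity and keeps exactly the \<open>r\<close> whose total is a multiple \<open>mnl\<close> of \<open>mn\<close>.
  Subtracting \<open>ml\<close> from each entry makes the total \<open>0\<close>; after that no exponent mixes \<open>l\<close> with the
  remaining tuple, so the double sum splits into the zero-sum series and
  \<open>\<vartheta>\<^sub>3(mnw + m\<Sum>x\<^sub>j | m\<^sup>2n\<tau>)\<close>. For \<open>a\<close> arguments \<open>x\<close> and \<open>b\<close> arguments \<open>y + \<pi>/2\<close> with
  \<open>ax + by = 0\<close>, the shift \<open>m\<Sum>x\<^sub>j\<close> is \<open>mb\<pi>/2\<close>, whence the parity of \<open>mb\<close> in the result.
\<close>

subsection \<open>The series of theta functions\<close>

definition theta_term :: "complex \<Rightarrow> complex \<Rightarrow> int \<Rightarrow> complex" where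
  "theta_term \<tau> z k = exp (\<i> * (of_real pi * \<tau> * (of_int k)\<^sup>2 + 2 * of_int k * z))"

lemma theta_term_eq_nome:
  "theta_term \<tau> z k = nome \<tau> powi k\<^sup>2 * exp (2 * of_int k * \<i> * z)"
  by (simp add: theta_term_def nome_def exp_power_int algebra_simps flip: exp_add)

lemma theta3_eq_infsum: "theta3 z \<tau> = infsum (theta_term \<tau> z) UNIV"
  unfolding theta3_def theta_term_eq_nome[abs_def] ..

lemma exp_of_int_mult_pi_i: "exp (of_int k * (of_real pi * \<i>)) = (-1 :: complex) powi k"
  by (metis exp_pi_i exp_power_int)

lemma theta_term_add_half_pi:
  "theta_term \<tau> (z + of_real pi / 2) k = (-1) powi k * theta_term \<tau> z k"
  unfolding theta_term_def exp_of_int_mult_pi_i[symmetric] by (simp add: algebra_simps flip: exp_add)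

lemma theta3_add_half_pi: "theta3 (z + of_real pi / 2) \<tau> = theta4 z \<tau>"
  unfolding theta3_eq_infsum theta4_def theta_term_add_half_pi
  by (simp add: theta_term_eq_nome mult.assoc)

lemma theta4_add_half_pi: "theta4 (z + of_real pi / 2) \<tau> = theta3 z \<tau>"
  unfolding theta3_add_half_pi[symmetric] theta3_eq_infsum theta_term_add_half_pi
  by (simp flip: mult.assoc power_int_mult_distrib)

lemma theta3_add_nat_half_pi:
  "theta3 (z + of_nat k * (of_real pi / 2)) \<tau> = (if even k then theta3 z \<tau> else theta4 z \<tau>)"
proof (induction k arbitrary: z)
  case (Suc k)
  have "theta3 (z + of_nat (Suc k) * (of_real pi / 2)) \<tau> =
      theta3 ((z + of_real pi / 2) + of_nat k * (of_real pi / 2)) \<tau>"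
    by (simp add: field_simps)
  also have "\<dots> = (if even (Suc k) then theta3 z \<tau> else theta4 z \<tau>)"
    by (simp only: Suc.IH theta3_add_half_pi theta4_add_half_pi) simp
  finally show ?case .
qed simp

lemma norm_theta_term:
  "norm (theta_term \<tau> z k) = exp (- (pi * Im \<tau>) * (of_int k)\<^sup>2 - 2 * of_int k * Im z)"
  by (simp add: theta_term_def power2_eq_square algebra_simps)

lemma summable_on_exp_minus_abs_int: "(\<lambda>k::int. exp (- real_of_int \<bar>k\<bar>)) summable_on UNIV"
proof -
  let ?f = "\<lambda>k::int. exp (- real_of_int \<bar>k\<bar>)"
  have "summable (\<lambda>k. exp (-1::real) ^ k)"
    by (rule summable_geometric) simp
  hence geometric: "(\<lambda>k. exp (-1::real) ^ k) summable_on UNIV"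
    by (intro norm_summable_imp_summable_on) simp
  have "?f summable_on range int"
    using geometric
    by (subst summable_on_reindex) (auto simp: o_def exp_of_nat_mult[symmetric])
  moreover have "?f summable_on range (\<lambda>k. - int k)"
    using geometric
    by (subst summable_on_reindex) (auto simp: o_def exp_of_nat_mult[symmetric] inj_def)
  ultimately have "?f summable_on range int \<union> range (\<lambda>k. - int k)"
    by (rule summable_on_union)
  also have "range int \<union> range (\<lambda>k. - int k) = UNIV"
    by (auto simp: image_iff) (metis int_cases2)
  finally show ?thesis .
qed

lemma quadratic_le_linear:
  fixes \<alpha> \<beta> t :: real
  assumes "\<alpha> > 0"
  shows "\<beta> * t - \<alpha> * t\<^sup>2 \<le> (\<beta> + 1)\<^sup>2 / (4 * \<alpha>) - t"
proof -
  have "0 \<le> (2 * \<alpha> * t - (\<beta> + 1))\<^sup>2 / (4 * \<alpha>)"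
    using assms by simp
  also have "\<dots> = \<alpha> * t\<^sup>2 - (\<beta> + 1) * t + (\<beta> + 1)\<^sup>2 / (4 * \<alpha>)"
    using assms by (simp add: field_simps power2_eq_square)
  finally show ?thesis
    by (simp add: algebra_simps)
qed

lemma theta_term_abs_summable:
  assumes "Im \<tau> > 0"
  shows "(\<lambda>k. norm (theta_term \<tau> z k)) summable_on UNIV"
proof (rule Infinite_Sum.abs_summable_on_comparison_test')
  define C where "C = (2 * \<bar>Im z\<bar> + 1)\<^sup>2 / (4 * (pi * Im \<tau>))"
  show "(\<lambda>k::int. exp C * exp (- real_of_int \<bar>k\<bar>)) summable_on UNIV"
    by (intro summable_on_cmult_right summable_on_exp_minus_abs_int)
  fix k :: int
  have "- (of_int k * Im z) \<le> \<bar>of_int k\<bar> * \<bar>Im z\<bar>"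
    by (metis abs_ge_minus_self abs_mult)
  hence "- (pi * Im \<tau>) * (of_int k)\<^sup>2 - 2 * of_int k * Im z
      \<le> 2 * \<bar>Im z\<bar> * \<bar>of_int k\<bar> - pi * Im \<tau> * \<bar>of_int k\<bar>\<^sup>2"
    by (simp add: algebra_simps)
  also have "\<dots> \<le> C - \<bar>of_int k\<bar>"
    unfolding C_def using assms by (intro quadratic_le_linear) simp
  finally show "norm (theta_term \<tau> z k) \<le> exp C * exp (- real_of_int \<bar>k\<bar>)"
    by (simp add: norm_theta_term flip: exp_add)
qed

subsection \<open>Products of theta functions\<close>

lemma has_sum_prod_PiE:
  fixes f :: "'a \<Rightarrow> 'b \<Rightarrow> 'c :: {real_normed_field, banach, second_countable_topology}"
  assumes "finite A" and "\<And>x. x \<in> A \<Longrightarrow> countable (B x)"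
    and "\<And>x. x \<in> A \<Longrightarrow> (\<lambda>y. norm (f x y)) summable_on B x"
  shows "((\<lambda>g. \<Prod>x\<in>A. f x (g x)) has_sum (\<Prod>x\<in>A. infsum (f x) (B x))) (PiE A B)"
proof -
  have "(\<lambda>g. norm (\<Prod>x\<in>A. f x (g x))) summable_on PiE A B"
    using abs_summable_on_prod_PiE[of A B f] assms by (simp add: abs_summable_equivalent)
  thus ?thesis
    using infsum_prod_PiE_abs[of A f B] assms abs_summable_summable has_sum_infsum by metis
qed

lemma prod_theta_term_add_arg:
  "(\<Prod>j\<in>J. theta_term \<tau> (w + x j) (r j)) =
    (\<Prod>j\<in>J. theta_term \<tau> (x j) (r j)) * exp (2 * \<i> * of_int (sum r J) * w)"
  by (induction J rule: infinite_finite_induct)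
     (simp_all add: theta_term_def algebra_simps flip: exp_add)

lemma has_sum_prod_theta3:
  assumes "Im \<tau> > 0" and "finite J"
  shows "((\<lambda>r. (\<Prod>j\<in>J. theta_term \<tau> (x j) (r j)) * exp (2 * \<i> * of_int (sum r J) * w))
    has_sum (\<Prod>j\<in>J. theta3 (w + x j) \<tau>)) (J \<rightarrow>\<^sub>E UNIV)"
  unfolding theta3_eq_infsum prod_theta_term_add_arg[symmetric]
  using assms by (intro has_sum_prod_PiE theta_term_abs_summable) simp_all

subsection \<open>Filtering a series by roots of unity\<close>

lemma exp_two_pi_i_div_eq_1_iff:
  assumes "N > 0"
  shows "exp (2 * \<i> * of_int t * (of_real pi / of_nat N)) = 1 \<longleftrightarrow> int N dvd t"
proof -
  have "exp (2 * \<i> * of_int t * (of_real pi / of_nat N)) = 1 \<longleftrightarrow>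
      (\<exists>l::int. 2 * t * (pi / N) = of_int (2 * l) * pi)"
    by (subst exp_eq_1) (simp add: Im_divide power2_eq_square mult.assoc)
  also have "\<dots> \<longleftrightarrow> (\<exists>l::int. real_of_int t = real_of_int (int N * l))"
    using assms by (simp add: field_simps)
  also have "\<dots> \<longleftrightarrow> int N dvd t"
    unfolding of_int_eq_iff by (auto simp: dvd_def)
  finally show ?thesis .
qed

lemma sum_powers_root_of_unity:
  assumes "N > 0"
  shows "(\<Sum>k<N. exp (2 * \<i> * of_int t * (of_real pi / of_nat N)) ^ k) =
    (if int N dvd t then of_nat N else (0 :: complex))"
proof -
  define \<omega> where "\<omega> = exp (2 * \<i> * of_int t * (of_real pi / of_nat N))"
  have "\<omega> ^ N = exp (\<i> * (of_int t * (of_real pi * 2)))"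
    using assms unfolding \<omega>_def exp_of_nat_mult[symmetric] by (simp add: mult_ac)
  hence "\<omega> ^ N = 1"
    by simp
  thus ?thesis
    unfolding \<omega>_def[symmetric] exp_two_pi_i_div_eq_1_iff[OF assms, of t, folded \<omega>_def, symmetric]
    by (simp add: geometric_sum)
qed

lemma has_sum_sum:
  fixes f :: "'i \<Rightarrow> 'a \<Rightarrow> 'b :: topological_comm_monoid_add"
  assumes "\<And>i. i \<in> I \<Longrightarrow> (f i has_sum S i) A"
  shows "((\<lambda>x. \<Sum>i\<in>I. f i x) has_sum (\<Sum>i\<in>I. S i)) A"
  using assms by (induction I rule: infinite_finite_induct) (auto intro: has_sum_add)

lemma has_sum_roots_of_unity_filter:
  fixes f :: "'a \<Rightarrow> complex" and t :: "'a \<Rightarrow> int"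
  assumes "N > 0" and F: "\<And>w. ((\<lambda>p. f p * exp (2 * \<i> * of_int (t p) * w)) has_sum F w) A"
  shows "((\<lambda>p. of_nat N * (f p * exp (2 * \<i> * of_int (t p) * w))) has_sum
    (\<Sum>k<N. F (w + of_nat k * of_real pi / of_nat N))) {p \<in> A. int N dvd t p}"
proof -
  let ?e = "\<lambda>p w. exp (2 * \<i> * of_int (t p) * w)"
  let ?w = "\<lambda>k. w + of_nat k * of_real pi / of_nat N"
  have "(\<Sum>k<N. f p * ?e p (?w k)) = (if int N dvd t p then of_nat N * (f p * ?e p w) else 0)" for p
  proof -
    have "?e p (?w k) = ?e p w * ?e p (of_real pi / of_nat N) ^ k" for k
      unfolding exp_of_nat_mult[symmetric] exp_add[symmetric] by (simp add: ring_distribs mult_ac)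
    hence "(\<Sum>k<N. f p * ?e p (?w k)) = f p * ?e p w * (\<Sum>k<N. ?e p (of_real pi / of_nat N) ^ k)"
      by (simp only: sum_distrib_left mult.assoc)
    thus ?thesis
      by (simp only: sum_powers_root_of_unity[OF assms(1)]) simp
  qed
  moreover have "((\<lambda>p. \<Sum>k<N. f p * ?e p (?w k)) has_sum (\<Sum>k<N. F (?w k))) A"
    by (intro has_sum_sum F)
  ultimately have "((\<lambda>p. if int N dvd t p then of_nat N * (f p * ?e p w) else 0) has_sum
      (\<Sum>k<N. F (?w k))) A"
    by (simp only:)
  thus ?thesis
    by (rule has_sum_cong_neutral[THEN iffD1, rotated -1]) auto
qed

subsection \<open>Translating integer tuples to zero sum\<close>

definition zero_sum_PiE :: "'a set \<Rightarrow> ('a \<Rightarrow> int) set" where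
  "zero_sum_PiE J = {r \<in> J \<rightarrow>\<^sub>E UNIV. sum r J = 0}"

definition translate :: "'a set \<Rightarrow> 'b :: plus \<Rightarrow> ('a \<Rightarrow> 'b) \<Rightarrow> 'a \<Rightarrow> 'b" where
  "translate J d r = (\<lambda>j\<in>J. r j + d)"

lemma translate_in_PiE: "translate J d r \<in> J \<rightarrow>\<^sub>E UNIV"
  by (simp add: translate_def)

lemma sum_translate:
  fixes r :: "'a \<Rightarrow> 'b :: comm_semiring_1"
  shows "sum (translate J d r) J = sum r J + of_nat (card J) * d"
  by (simp add: translate_def sum.distrib)

lemma translate_translate:
  fixes r :: "'a \<Rightarrow> 'b :: ab_semigroup_add"
  shows "translate J d (translate J e r) = translate J (d + e) r"
  by (simp add: translate_def fun_eq_iff add_ac)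

lemma translate_0:
  fixes r :: "'a \<Rightarrow> 'b :: monoid_add"
  shows "r \<in> J \<rightarrow>\<^sub>E UNIV \<Longrightarrow> translate J 0 r = r"
  by (simp add: translate_def PiE_restrict)

lemma bij_betw_translate_zero_sum:
  assumes "finite J" and "J \<noteq> {}" and "m > 0"
  shows "bij_betw (\<lambda>(l, r). translate J (int m * l) r) (UNIV \<times> zero_sum_PiE J)
    {r \<in> J \<rightarrow>\<^sub>E UNIV. int (m * card J) dvd sum r J}"
proof (rule bij_betw_byWitness)
  let ?N = "int (m * card J)"
  let ?f = "\<lambda>(l, r). translate J (int m * l) r"
  let ?g = "\<lambda>r. (sum r J div ?N, translate J (- (int m * (sum r J div ?N))) r)"
  have sum_shift: "sum (translate J (int m * l) r) J = sum r J + ?N * l" for l r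
    by (simp add: sum_translate)
  have sum_unshift: "sum (translate J (- (int m * l)) r) J = sum r J - ?N * l" for l r
    by (simp add: sum_translate)
  have "?N \<noteq> 0"
    using assms by simp
  thus "\<forall>q\<in>UNIV \<times> zero_sum_PiE J. ?g (?f q) = q"
    by (auto simp: zero_sum_PiE_def sum_shift translate_translate translate_0 simp del: of_nat_mult)
  show "\<forall>r\<in>{r \<in> J \<rightarrow>\<^sub>E UNIV. ?N dvd sum r J}. ?f (?g r) = r"
    by (auto simp: translate_translate translate_0)
  show "?f ` (UNIV \<times> zero_sum_PiE J) \<subseteq> {r \<in> J \<rightarrow>\<^sub>E UNIV. ?N dvd sum r J}"
    by (auto simp: zero_sum_PiE_def sum_shift intro!: translate_in_PiE simp del: of_nat_mult)
  show "?g ` {r \<in> J \<rightarrow>\<^sub>E UNIV. ?N dvd sum r J} \<subseteq> UNIV \<times> zero_sum_PiE J"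
    by (auto simp: zero_sum_PiE_def sum_unshift intro!: translate_in_PiE simp del: of_nat_mult)
qed

lemma prod_theta_term_const_index:
  "(\<Prod>j\<in>J. theta_term \<tau> (x j) d) = theta_term (of_nat (card J) * \<tau>) (sum x J) d"
  by (induction J rule: infinite_finite_induct)
     (simp_all add: theta_term_def algebra_simps flip: exp_add)

lemma prod_theta_term_translate:
  assumes "finite J" and "sum r J = 0"
  shows "(\<Prod>j\<in>J. theta_term \<tau> (x j) (translate J d r j)) =
    theta_term (of_nat (card J) * \<tau>) (sum x J) d * (\<Prod>j\<in>J. theta_term \<tau> (x j) (r j))"
proof -
  have "theta_term \<tau> (x j) (r j + d) = theta_term \<tau> (x j) d * theta_term \<tau> (x j) (r j) *
      exp (2 * of_real pi * \<i> * \<tau> * of_int d * of_int (r j))" for j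
    by (simp add: theta_term_def power2_sum algebra_simps flip: exp_add)
  moreover have "(\<Prod>j\<in>J. exp (2 * of_real pi * \<i> * \<tau> * of_int d * of_int (r j))) = 1"
    using assms by (simp flip: exp_sum sum_distrib_left of_int_sum)
  ultimately show ?thesis
    by (simp add: translate_def prod.distrib prod_theta_term_const_index)
qed

subsection \<open>The averaged product of theta functions\<close>

definition zero_sum_theta :: "'a set \<Rightarrow> ('a \<Rightarrow> complex) \<Rightarrow> complex \<Rightarrow> complex" where
  "zero_sum_theta J x \<tau> = (\<Sum>\<^sub>\<infinity>r\<in>zero_sum_PiE J. \<Prod>j\<in>J. theta_term \<tau> (x j) (r j))"

lemma infsum_Times_mult:
  fixes f :: "'a \<Rightarrow> 'c :: {banach, real_normed_field}" and g :: "'b \<Rightarrow> 'c"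
  assumes "(\<lambda>(x, y). f x * g y) summable_on A \<times> B"
  shows "infsum (\<lambda>(x, y). f x * g y) (A \<times> B) = infsum f A * infsum g B"
  using infsum_Sigma'_banach[OF assms] by (simp add: infsum_cmult_right' infsum_cmult_left')

theorem sum_prod_theta3:
  assumes "Im \<tau> > 0" and J: "finite J" "J \<noteq> {}" and "m > 0"
  shows "(\<Sum>k<m * card J. \<Prod>j\<in>J. theta3 (w + of_nat k * of_real pi / of_nat (m * card J) + x j) \<tau>) =
    of_nat (m * card J) * zero_sum_theta J x \<tau> *
      theta3 (of_nat (m * card J) * w + of_nat m * sum x J) (of_nat (m\<^sup>2 * card J) * \<tau>)"
    (is "?S = _ * _ * theta3 ?w ?\<tau>")
proof -
  let ?N = "m * card J"
  let ?P = "\<lambda>r. \<Prod>j\<in>J. theta_term \<tau> (x j) (r j)"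
  let ?h = "\<lambda>r. of_nat ?N * (?P r * exp (2 * \<i> * of_int (sum r J) * w))"
  have "?N > 0"
    using assms by (simp add: card_gt_0_iff)
  hence "(?h has_sum ?S) {r \<in> J \<rightarrow>\<^sub>E UNIV. int ?N dvd sum r J}"
    by (rule has_sum_roots_of_unity_filter) (rule has_sum_prod_theta3[OF assms(1) J(1)])
  hence translated: "((\<lambda>q. ?h (case q of (l, r) \<Rightarrow> translate J (int m * l) r)) has_sum ?S)
      (UNIV \<times> zero_sum_PiE J)"
    by (subst has_sum_reindex_bij_betw[OF bij_betw_translate_zero_sum[OF J \<open>m > 0\<close>]])
  have term_splits: "?h (translate J (int m * l) r) = theta_term ?\<tau> ?w l * (of_nat ?N * ?P r)"
    if "r \<in> zero_sum_PiE J" for l r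
  proof -
    have "sum r J = 0"
      using that by (simp add: zero_sum_PiE_def)
    moreover have "theta_term (of_nat (card J) * \<tau>) (sum x J) (int m * l) *
        exp (2 * \<i> * of_int (int (card J) * (int m * l)) * w) = theta_term ?\<tau> ?w l"
      by (simp add: theta_term_def power_mult_distrib algebra_simps flip: exp_add)
    ultimately show ?thesis
      by (simp only: prod_theta_term_translate[OF J(1)] sum_translate add_0 mult_ac)
  qed
  have "((\<lambda>(l, r). theta_term ?\<tau> ?w l * (of_nat ?N * ?P r)) has_sum ?S) (UNIV \<times> zero_sum_PiE J)"
    by (rule has_sum_cong[THEN iffD1, OF _ translated], elim SigmaE)
       (simp only: prod.case term_splits)
  hence "?S = infsum (theta_term ?\<tau> ?w) UNIV * (\<Sum>\<^sub>\<infinity>r\<in>zero_sum_PiE J. of_nat ?N * ?P r)"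
    by (simp only: infsum_Times_mult[OF has_sum_imp_summable, symmetric] infsumI)
  thus ?thesis
    by (simp add: theta3_eq_infsum zero_sum_theta_def infsum_cmult_right')
qed

subsection \<open>Mixed powers of two theta functions\<close>

lemma bij_betw_case_sum_PiE:
  "bij_betw (\<lambda>(f, g). case_sum f g) ((A \<rightarrow>\<^sub>E C) \<times> (B \<rightarrow>\<^sub>E C)) (A <+> B \<rightarrow>\<^sub>E C)"
proof (rule bij_betw_byWitness[where f' = "\<lambda>h. (h \<circ> Inl, h \<circ> Inr)"])
  show "\<forall>h\<in>A <+> B \<rightarrow>\<^sub>E C. (case (h \<circ> Inl, h \<circ> Inr) of (f, g) \<Rightarrow> case_sum f g) = h"
    by (simp add: fun_eq_iff split: sum.splits)
  show "(\<lambda>(f, g). case_sum f g) ` ((A \<rightarrow>\<^sub>E C) \<times> (B \<rightarrow>\<^sub>E C)) \<subseteq> (A <+> B \<rightarrow>\<^sub>E C)"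
    by (auto simp: PiE_iff extensional_def split: sum.splits)
qed (auto simp: PiE_iff extensional_def)

lemma bij_betw_case_sum_zero_sum_tuples:
  "bij_betw (\<lambda>(r, s). case_sum r s) (zero_sum_tuples a b) (zero_sum_PiE ({1..a} <+> {1..b}))"
proof -
  have "zero_sum_tuples a b = {p \<in> ({1..a} \<rightarrow>\<^sub>E UNIV) \<times> ({1..b} \<rightarrow>\<^sub>E UNIV).
      (case p of (r, s) \<Rightarrow> (\<Sum>j=1..a. r j) + (\<Sum>j=1..b. s j)) = 0}"
    by (auto simp: zero_sum_tuples_def)
  thus ?thesis
    unfolding zero_sum_PiE_def
    by (simp only:) (rule bij_betw_Collect[OF bij_betw_case_sum_PiE], auto simp: sum.Plus)
qed

lemma prod_theta_term_const_arg:
  "(\<Prod>j\<in>J. theta_term \<tau> z (r j)) =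
    nome \<tau> powi (\<Sum>j\<in>J. (r j)\<^sup>2) * exp (2 * \<i> * of_int (\<Sum>j\<in>J. r j) * z)"
  by (induction J rule: infinite_finite_induct)
     (simp_all add: theta_term_eq_nome power_int_add nome_def exp_add algebra_simps)

definition theta34_args :: "complex \<Rightarrow> complex \<Rightarrow> 'a + 'b \<Rightarrow> complex" where
  "theta34_args x y = case_sum (\<lambda>_. x) (\<lambda>_. y + of_real pi / 2)"

lemma R34_eq_zero_sum_theta:
  "R34 a b x y m n \<tau> = of_nat (m * n) * zero_sum_theta ({1..a} <+> {1..b}) (theta34_args x y) \<tau>"
proof -
  have "(\<Prod>j\<in>{1..a} <+> {1..b}. theta_term \<tau> (theta34_args x y j) (case_sum r s j)) =
      (-1) powi (\<Sum>j=1..b. s j) *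
      nome \<tau> powi ((\<Sum>j=1..a. (r j)\<^sup>2) + (\<Sum>j=1..b. (s j)\<^sup>2)) *
      exp (2 * \<i> * (of_int (\<Sum>j=1..a. r j) * x + of_int (\<Sum>j=1..b. s j) * y))" for r s
    unfolding exp_of_int_mult_pi_i[symmetric]
    by (simp add: theta34_args_def prod.Plus prod_theta_term_const_arg power_int_add nome_def
        exp_add distrib_left mult_ac del: of_int_sum)
  thus ?thesis
    unfolding R34_def zero_sum_theta_def
      infsum_reindex_bij_betw[OF bij_betw_case_sum_zero_sum_tuples, symmetric]
    by (simp add: case_prod_unfold)
qed

lemma S34_eq_sum_prod_theta3:
  "S34 a b x y m n \<tau> z = (\<Sum>k<m * n. \<Prod>j\<in>{1..a} <+> {1..b}.
    theta3 (z + of_nat k * of_real pi / of_nat (m * n) + theta34_args x y j) \<tau>)"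
  by (simp add: S34_def theta34_args_def prod.Plus add_ac flip: theta3_add_half_pi)

theorem theorem3p14:
  fixes m n a b :: nat and x y \<tau> :: complex
  assumes "Im \<tau> > 0"
    and "m > 0" and "n > 0"
    and "a + b = n"
    and "of_nat a * x + of_nat b * y = 0"
  shows "\<forall>z :: complex.
    (even (m * b) \<longrightarrow>
       S34 a b x y m n \<tau> z =
         R34 a b x y m n \<tau> * theta3 (of_nat (m * n) * z) (of_nat (m\<^sup>2 * n) * \<tau>)) \<and>
    (odd (m * b) \<longrightarrow>
       S34 a b x y m n \<tau> z =
         R34 a b x y m n \<tau> * theta4 (of_nat (m * n) * z) (of_nat (m\<^sup>2 * n) * \<tau>))"
proof
  fix z
  let ?J = "{1..a} <+> {1..b}" and ?x = "theta34_args x y"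
  let ?\<tau> = "of_nat (m\<^sup>2 * n) * \<tau>"
  have J: "finite ?J" "?J \<noteq> {}" and card: "card ?J = n"
    using assms by (auto simp: card_Plus)
  have "S34 a b x y m n \<tau> z =
      R34 a b x y m n \<tau> * theta3 (of_nat (m * n) * z + of_nat m * sum ?x ?J) ?\<tau>"
    unfolding S34_eq_sum_prod_theta3 R34_eq_zero_sum_theta
    by (rule sum_prod_theta3[OF assms(1) J assms(2), unfolded card])
  also have "sum ?x ?J = of_nat a * x + of_nat b * y + of_nat b * (of_real pi / 2)"
    by (simp add: theta34_args_def sum.Plus algebra_simps)
  also have "of_nat m * \<dots> = of_nat (m * b) * (of_real pi / 2)"
    using assms by simp
  finally show "(even (m * b) \<longrightarrow> S34 a b x y m n \<tau> z =
        R34 a b x y m n \<tau> * theta3 (of_nat (m * n) * z) ?\<tau>) \<and>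
      (odd (m * b) \<longrightarrow> S34 a b x y m n \<tau> z =
        R34 a b x y m n \<tau> * theta4 (of_nat (m * n) * z) ?\<tau>)"
    by (simp only: theta3_add_nat_half_pi) simp
qed

end
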